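(* Assume $\mathrm{cf}(\kappa)=\omega$. Let $\mu:\omega\to\kappa\setminus\{0\}$ be a non-decreasing function with $\lim_{n\to\omega}\mu(n)=\kappa$, and let $\lambda=\kappa^\omega$. Let $T\in\mathbb{P}$ and let $\dot g$ be a $\mathbb{P}$-name with $T\Vdash \dot g:\omega\to\check\lambda$. Then there are a condition $Q\le T$ and a function $f$ in the ground model with domain $\omega$ such that for every $n\in\omega$, $|f(n)|\le\mu(n)$ and $Q\Vdash \dot g(\check n)\in\check f(\check n)$.
   Context: $\kappa$ is a singular cardinal and $\langle \kappa_n:n<\omega\rangle$ is a strictly increasing sequence of regular cardinals with supremum $\kappa$ such that $\omega<\kappa_n<\kappa$ for all $n$. Standing assumption: $\mu^{\omega}<\kappa$ for every cardinal $\mu<\kappa$. Let $N$ be the set of finite sequences $t$ with $t(i)<\kappa_i$ for all $i\in\mathrm{dom}(t)$, and $X$ the set of functions $f$ on $\omega$ with $f(i)<\kappa_i$ for all $i$. A tree is a subset $T\subseteq N$ closed under initial segments; $[T]=\{f\in X: f\restriction n\in T\ \forall n\}$; $\mathrm{Succ}_T(t)$ is the set of one-point extensions of $t$ in $T$. A tree $T$ is perfect if it is nonempty, every $t\in T$ has an extension in $[T]$, and for every $n<\omega$ and $t\in T$ there is $t'\in T$ extending $t$ with $|\mathrm{Succ}_T(t')|\ge\kappa_n$. $\mathbb{P}$ is the set of perfect trees ordered by inclusion ($Q\le T$ iff $Q\subseteq T$). *)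

theory Defs
  imports Main "HOL-Library.Sublist"
begin

unbundle cardinal_syntax

section \<open>Ordinals and cardinals\<close>

text \<open>
  An ordinal is given by a well-ordered type whose elements are the smaller ordinals: \<open>wo\<close> is the
  order type of the whole type, and \<open>seg a\<close> is the ordinal \<open>a\<close>, seen as the order type of its set of
  predecessors. Ordinals are compared by \<open>\<le>o\<close> and \<open><o\<close>; cardinals are the well-orders satisfying
  \<open>Card_order\<close>.
\<close>

definition wo :: "'a::wellorder rel" where
  "wo = {(x, y). x \<le> y}"

definition seg :: "'a::wellorder \<Rightarrow> 'a rel" where
  "seg a = {(x, y). x \<le> y \<and> y < a}"

definition has_cofinality :: "'a rel \<Rightarrow> 'b rel \<Rightarrow> bool" where
  "has_cofinality r c \<longleftrightarrow>
     (\<exists>A \<subseteq> Field r. cofinal A r \<and> |A| =o c) \<and> (\<forall>B \<subseteq> Field r. cofinal B r \<longrightarrow> c \<le>o |B| )"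

text \<open>
  Here \<open>'k\<close> is the cardinal \<open>\<kappa>\<close>, so \<open>\<kappa>\<^sub>n < \<kappa>\<close> holds by typing.
\<close>

locale singular_setting =
  fixes kap :: "nat \<Rightarrow> 'k::wellorder"
  assumes kappa_cardinal: "card_order (wo :: 'k rel)" "cinfinite (wo :: 'k rel)"
    and kappa_singular: "\<not> regularCard (wo :: 'k rel)"
    and kap_strict_mono: "strict_mono kap"
    and kap_regular: "\<And>n. Card_order (seg (kap n)) \<and> regularCard (seg (kap n))"
    and kap_uncountable: "\<And>n. natLeq <o seg (kap n)"
    and kap_sup: "\<And>a. \<exists>n. a < kap n"
    and omega_power: "\<And>a::'k. Card_order (seg a) \<Longrightarrow> seg a ^c natLeq <o (wo :: 'k rel)"


section \<open>Perfect trees\<close>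

definition seqs :: "(nat \<Rightarrow> 'k::wellorder) \<Rightarrow> 'k list set" where
  "seqs kap = {t. \<forall>i < length t. t ! i < kap i}"

definition full_seqs :: "(nat \<Rightarrow> 'k::wellorder) \<Rightarrow> (nat \<Rightarrow> 'k) set" where
  "full_seqs kap = {f. \<forall>i. f i < kap i}"

definition restr :: "(nat \<Rightarrow> 'k) \<Rightarrow> nat \<Rightarrow> 'k list" where
  "restr f n = map f [0..<n]"

definition is_tree :: "(nat \<Rightarrow> 'k::wellorder) \<Rightarrow> 'k list set \<Rightarrow> bool" where
  "is_tree kap T \<longleftrightarrow> T \<subseteq> seqs kap \<and> (\<forall>t \<in> T. \<forall>s. prefix s t \<longrightarrow> s \<in> T)"

definition branches :: "(nat \<Rightarrow> 'k::wellorder) \<Rightarrow> 'k list set \<Rightarrow> (nat \<Rightarrow> 'k) set" where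
  "branches kap T = {f \<in> full_seqs kap. \<forall>n. restr f n \<in> T}"

definition Succs :: "'k list set \<Rightarrow> 'k list \<Rightarrow> 'k list set" where
  "Succs T t = {s \<in> T. \<exists>a. s = t @ [a]}"

definition perfect_tree :: "(nat \<Rightarrow> 'k::wellorder) \<Rightarrow> 'k list set \<Rightarrow> bool" where
  "perfect_tree kap T \<longleftrightarrow> is_tree kap T \<and> T \<noteq> {} \<and>
     (\<forall>t \<in> T. \<exists>f \<in> branches kap T. restr f (length t) = t) \<and>
     (\<forall>n. \<forall>t \<in> T. \<exists>t' \<in> T. prefix t t' \<and> seg (kap n) \<le>o |Succs T t'| )"

text \<open>
  The forcing: conditions are \<open>perfect_trees kap\<close>, ordered by \<open>\<subseteq>\<close>, with largest condition
  \<open>seqs kap\<close>.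
\<close>

definition perfect_trees :: "(nat \<Rightarrow> 'k::wellorder) \<Rightarrow> 'k list set set" where
  "perfect_trees kap = {T. perfect_tree kap T}"


section \<open>Names\<close>

text \<open>
  The ground model is the universe of HOL. \<open>Name x s\<close> is the name \<open>{(x i, s i) | i :: 'i}\<close>. In HOL,
  the size of such a set has to be bounded by some index type \<open>'i\<close>; as \<open>'i\<close> is arbitrary, this is no
  restriction on names. Repetitions allow for smaller nonempty sets.
\<close>

datatype ('p, 'i) name = Empty | Name "'i \<Rightarrow> ('p, 'i) name" "'i \<Rightarrow> 'p"

primrec pairs :: "('p, 'i) name \<Rightarrow> (('p, 'i) name \<times> 'p) set" where
  "pairs Empty = {}"
| "pairs (Name x s) = range (\<lambda>i. (x i, s i))"

text \<open>\<open>is_name P \<tau>\<close>: hereditarily, only conditions from \<open>P\<close> occur in \<open>\<tau>\<close>.\<close>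

primrec is_name :: "'p set \<Rightarrow> ('p, 'i) name \<Rightarrow> bool" where
  "is_name P Empty \<longleftrightarrow> True"
| "is_name P (Name x s) \<longleftrightarrow> (\<forall>i. is_name P (x i) \<and> s i \<in> P)"

text \<open>
  The name with a given set of pairs; meaningful for sets of pairs not larger than \<open>'i\<close>
  (see \<open>pairs_mk_name\<close>).
\<close>

definition mk_name :: "(('p, 'i) name \<times> 'p) set \<Rightarrow> ('p, 'i) name" where
  "mk_name A = (SOME \<tau>. pairs \<tau> = A)"

lemma pairs_mk_name:
  fixes A :: "(('p, 'i) name \<times> 'p) set"
  assumes "|A| \<le>o |UNIV :: 'i set|"
  shows "pairs (mk_name A) = A"
proof -
  have "\<exists>\<tau>. pairs \<tau> = A"
  proof (cases "A = {}")
    case True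
    then show ?thesis by (intro exI[of _ Empty]) simp
  next
    case False
    then obtain h :: "'i \<Rightarrow> ('p, 'i) name \<times> 'p" where "range h = A"
      using assms card_of_ordLeq2[of A "UNIV :: 'i set"] by auto
    then show ?thesis by (intro exI[of _ "Name (fst \<circ> h) (snd \<circ> h)"]) simp
  qed
  then show ?thesis
    unfolding mk_name_def by (rule someI_ex)
qed

text \<open>
  In the following, \<open>one\<close> is the largest condition. Ordinals, sets of ordinals, and functions from
  \<open>\<omega>\<close> to sets of ordinals have check names; \<open>op_name\<close> is the usual name for the Kuratowski pair.
\<close>

function check_ord :: "'p \<Rightarrow> 'a::wellorder \<Rightarrow> ('p, 'i) name" where
  "check_ord one a = mk_name ((\<lambda>b. (check_ord one b, one)) ` {..<a})"
  by pat_completeness auto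
termination
  by (relation "inv_image {(x, y). x < y} snd") (auto intro: wf)

declare check_ord.simps [simp del]

definition check_set :: "'p \<Rightarrow> 'a::wellorder set \<Rightarrow> ('p, 'i) name" where
  "check_set one A = mk_name ((\<lambda>a. (check_ord one a, one)) ` A)"

definition op_name :: "'p \<Rightarrow> ('p, 'i) name \<Rightarrow> ('p, 'i) name \<Rightarrow> ('p, 'i) name" where
  "op_name one \<sigma> \<tau> =
     mk_name {(mk_name {(\<sigma>, one)}, one), (mk_name {(\<sigma>, one), (\<tau>, one)}, one)}"

definition check_fun :: "'p \<Rightarrow> (nat \<Rightarrow> 'a::wellorder set) \<Rightarrow> ('p, 'i) name" where
  "check_fun one f =
     mk_name (range (\<lambda>n. (op_name one (check_ord one n) (check_set one (f n)), one)))"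


section \<open>The forcing relation\<close>

definition dense_below :: "'p set \<Rightarrow> ('p \<Rightarrow> 'p \<Rightarrow> bool) \<Rightarrow> 'p \<Rightarrow> ('p \<Rightarrow> bool) \<Rightarrow> bool" where
  "dense_below P le p D \<longleftrightarrow> (\<forall>r \<in> P. le r p \<longrightarrow> (\<exists>q \<in> P. le q r \<and> D q))"

text \<open>
  The usual recursive definition of forcing in the ground model. Equality is defined by
  recursion on the name on the left: a condition forces \<open>\<sigma> = \<tau>\<close> iff for every \<open>(\<pi>, s) \<in> \<sigma>\<close> it is dense
  that, if \<open>s\<close> is in the generic filter, then \<open>\<pi>\<close> is equal to an element of \<open>\<tau>\<close>, and vice versa.
\<close>

primrec forces_eq ::
  "'p set \<Rightarrow> ('p \<Rightarrow> 'p \<Rightarrow> bool) \<Rightarrow> ('p, 'i) name \<Rightarrow> ('p, 'i) name \<Rightarrow> 'p \<Rightarrow> bool" where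
  "forces_eq P le Empty \<tau> p \<longleftrightarrow>
     (\<forall>(\<pi>, u) \<in> pairs \<tau>. dense_below P le p (\<lambda>q. \<not> le q u))"
| "forces_eq P le (Name x s) \<tau> p \<longleftrightarrow>
     (\<forall>i. dense_below P le p
        (\<lambda>q. le q (s i) \<longrightarrow> (\<exists>(\<pi>, u) \<in> pairs \<tau>. le q u \<and> forces_eq P le (x i) \<pi> q))) \<and>
     (\<forall>(\<pi>, u) \<in> pairs \<tau>. dense_below P le p
        (\<lambda>q. le q u \<longrightarrow> (\<exists>i. le q (s i) \<and> forces_eq P le (x i) \<pi> q)))"

lemma forces_eq_iff:
  "forces_eq P le \<sigma> \<tau> p \<longleftrightarrow>
     (\<forall>(\<pi>\<^sub>1, s\<^sub>1) \<in> pairs \<sigma>. dense_below P le p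
        (\<lambda>q. le q s\<^sub>1 \<longrightarrow> (\<exists>(\<pi>\<^sub>2, s\<^sub>2) \<in> pairs \<tau>. le q s\<^sub>2 \<and> forces_eq P le \<pi>\<^sub>1 \<pi>\<^sub>2 q))) \<and>
     (\<forall>(\<pi>\<^sub>2, s\<^sub>2) \<in> pairs \<tau>. dense_below P le p
        (\<lambda>q. le q s\<^sub>2 \<longrightarrow> (\<exists>(\<pi>\<^sub>1, s\<^sub>1) \<in> pairs \<sigma>. le q s\<^sub>1 \<and> forces_eq P le \<pi>\<^sub>1 \<pi>\<^sub>2 q)))"
  by (cases \<sigma>) auto

definition forces_mem ::
  "'p set \<Rightarrow> ('p \<Rightarrow> 'p \<Rightarrow> bool) \<Rightarrow> ('p, 'i) name \<Rightarrow> ('p, 'i) name \<Rightarrow> 'p \<Rightarrow> bool" where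
  "forces_mem P le \<sigma> \<tau> p \<longleftrightarrow>
     dense_below P le p (\<lambda>q. \<exists>(\<pi>, u) \<in> pairs \<tau>. le q u \<and> forces_eq P le \<sigma> \<pi> q)"

text \<open>
  Formulas of the forcing language, with names as constants. The binder is represented by a function
  that instantiates the bound variable.
\<close>

datatype 'n fm =
    Mem 'n 'n  (infix \<open>\<^bold>\<in>\<close> 65)
  | Eq 'n 'n  (infix \<open>\<^bold>=\<close> 65)
  | Neg "'n fm"
  | And "'n fm" "'n fm"  (infixr \<open>\<^bold>\<and>\<close> 60)
  | Ex "'n \<Rightarrow> 'n fm"  (binder \<open>\<^bold>\<exists>\<close> 55)

abbreviation Imp :: "'n fm \<Rightarrow> 'n fm \<Rightarrow> 'n fm"  (infixr \<open>\<^bold>\<longrightarrow>\<close> 58) where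
  "\<phi> \<^bold>\<longrightarrow> \<psi> \<equiv> Neg (\<phi> \<^bold>\<and> Neg \<psi>)"

abbreviation All :: "('n \<Rightarrow> 'n fm) \<Rightarrow> 'n fm"  (binder \<open>\<^bold>\<forall>\<close> 55) where
  "All F \<equiv> Neg (Ex (\<lambda>x. Neg (F x)))"

text \<open>
  The quantifiers range over the names with index type \<open>'i\<close>. The only formulas used below are
  \<open>\<Delta>\<^sub>0\<close>, with all parameters among these names, so that they are absolute and this range is
  immaterial.
\<close>

primrec forces ::
  "'p set \<Rightarrow> ('p \<Rightarrow> 'p \<Rightarrow> bool) \<Rightarrow> 'p \<Rightarrow> ('p, 'i) name fm \<Rightarrow> bool" where
  "forces P le p (\<sigma> \<^bold>\<in> \<tau>) \<longleftrightarrow> forces_mem P le \<sigma> \<tau> p"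
| "forces P le p (\<sigma> \<^bold>= \<tau>) \<longleftrightarrow> forces_eq P le \<sigma> \<tau> p"
| "forces P le p (Neg \<phi>) \<longleftrightarrow> (\<forall>q \<in> P. le q p \<longrightarrow> \<not> forces P le q \<phi>)"
| "forces P le p (\<phi> \<^bold>\<and> \<psi>) \<longleftrightarrow> forces P le p \<phi> \<and> forces P le p \<psi>"
| "forces P le p (Ex F) \<longleftrightarrow>
     dense_below P le p (\<lambda>q. \<exists>\<sigma>. is_name P \<sigma> \<and> forces P le q (F \<sigma>))"

text \<open>\<open>g\<close> is a function from \<open>A\<close> to \<open>B\<close>.\<close>

definition is_fun_fm ::
  "'p \<Rightarrow> ('p, 'i) name \<Rightarrow> ('p, 'i) name \<Rightarrow> ('p, 'i) name \<Rightarrow> ('p, 'i) name fm" where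
  "is_fun_fm one g A B =
     ((\<^bold>\<forall>z. z \<^bold>\<in> g \<^bold>\<longrightarrow> (\<^bold>\<exists>x. x \<^bold>\<in> A \<^bold>\<and> (\<^bold>\<exists>y. y \<^bold>\<in> B \<^bold>\<and> z \<^bold>= op_name one x y))) \<^bold>\<and>
      (\<^bold>\<forall>x. x \<^bold>\<in> A \<^bold>\<longrightarrow> (\<^bold>\<exists>y. op_name one x y \<^bold>\<in> g \<^bold>\<and>
         (\<^bold>\<forall>y'. op_name one x y' \<^bold>\<in> g \<^bold>\<longrightarrow> y' \<^bold>= y))))"

text \<open>\<open>g(x) \<in> f(x)\<close>, where \<open>g\<close> and \<open>f\<close> are functions with \<open>x\<close> in their domains.\<close>

definition app_mem_app_fm ::
  "'p \<Rightarrow> ('p, 'i) name \<Rightarrow> ('p, 'i) name \<Rightarrow> ('p, 'i) name \<Rightarrow> ('p, 'i) name fm" where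
  "app_mem_app_fm one g f x =
     (\<^bold>\<exists>y. \<^bold>\<exists>z. op_name one x y \<^bold>\<in> g \<^bold>\<and> op_name one x z \<^bold>\<in> f \<^bold>\<and> y \<^bold>\<in> z)"

end

theory Submission
  imports Defs
begin

text \<open>
  For each \<open>k\<close> only finitely many \<open>n\<close> satisfy \<open>\<mu> n < kap k\<close>, so below any condition there is one that
  decides \<open>g\<close> at all of them. Fuse: decide these values for \<open>k = 0\<close>, choose a node with \<open>kap 0\<close>
  successors, decide the values for \<open>k = 1\<close> above each of them, choose nodes with \<open>kap 1\<close> successors
  above, and so on. The tree \<open>Q\<close> generated by the chosen nodes is perfect, and it has one node of
  level \<open>0\<close> and at most \<open>kap k\<close> nodes of level \<open>k + 1\<close>. If \<open>k\<close> is least with \<open>\<mu> n < kap k\<close>, then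
  \<open>g n\<close> is decided at level \<open>k\<close>, and so it has at most \<open>\<mu> n\<close> possible values below \<open>Q\<close>.
\<close>

section \<open>The forcing relation\<close>

lemma dense_belowI:
  assumes "\<And>r. r \<in> P \<Longrightarrow> le r p \<Longrightarrow> \<exists>q \<in> P. le q r \<and> D q"
  shows "dense_below P le p D"
  using assms unfolding dense_below_def by blast

lemma dense_belowE:
  assumes "dense_below P le p D" "r \<in> P" "le r p"
  obtains q where "q \<in> P" "le q r" "D q"
  using assms unfolding dense_below_def by blast

text \<open>Merges the cases \<open>Empty\<close> and \<open>Name\<close>, so that later inductions
  see a name only through \<open>pairs\<close>, as in membership induction on names.\<close>

lemma name_pairs_induct [case_names step]:
  assumes "\<And>\<sigma>. (\<And>\<pi> s. (\<pi>, s) \<in> pairs \<sigma> \<Longrightarrow> Q \<pi>) \<Longrightarrow> Q \<sigma>"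
  shows "Q \<sigma>"
proof (induction \<sigma>)
  case Empty
  show ?case by (rule assms) simp
next
  case (Name x s)
  show ?case by (rule assms) (use Name in auto)
qed

text \<open>The preorder laws are assumed on the whole type, which inclusion satisfies, so that
  comparing conditions needs no membership in \<open>P\<close>.\<close>

locale forcing_preorder =
  fixes P :: "'p set" and le :: "'p \<Rightarrow> 'p \<Rightarrow> bool"
  assumes le_refl: "le p p"
    and le_trans: "le p q \<Longrightarrow> le q r \<Longrightarrow> le p r"
begin

section \<open>Monotonicity, and forced equality as an equivalence relation\<close>

lemma dense_below_mono: "dense_below P le p D \<Longrightarrow> le q p \<Longrightarrow> dense_below P le q D"
  unfolding dense_below_def using le_trans by blast

lemma forces_eqI:
  assumes left: "\<And>\<pi>\<^sub>1 s\<^sub>1. (\<pi>\<^sub>1, s\<^sub>1) \<in> pairs \<sigma> \<Longrightarrow> dense_below P le p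
        (\<lambda>q. le q s\<^sub>1 \<longrightarrow> (\<exists>(\<pi>\<^sub>2, s\<^sub>2) \<in> pairs \<tau>. le q s\<^sub>2 \<and> forces_eq P le \<pi>\<^sub>1 \<pi>\<^sub>2 q))"
    and right: "\<And>\<pi>\<^sub>2 s\<^sub>2. (\<pi>\<^sub>2, s\<^sub>2) \<in> pairs \<tau> \<Longrightarrow> dense_below P le p
        (\<lambda>q. le q s\<^sub>2 \<longrightarrow> (\<exists>(\<pi>\<^sub>1, s\<^sub>1) \<in> pairs \<sigma>. le q s\<^sub>1 \<and> forces_eq P le \<pi>\<^sub>1 \<pi>\<^sub>2 q))"
  shows "forces_eq P le \<sigma> \<tau> p"
  by (subst forces_eq_iff, intro conjI ballI case_prodI2; hypsubst) (erule left, erule right)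

text \<open>The implication inside the density statement can be discharged because every condition
  below \<open>q\<close> stays below \<open>s\<^sub>1\<close>. The other half of the definition is
  reached by applying this after \<open>forces_eq_sym\<close>.\<close>

lemma forces_eq_left:
  assumes "forces_eq P le \<sigma> \<tau> p" "(\<pi>\<^sub>1, s\<^sub>1) \<in> pairs \<sigma>" "q \<in> P" "le q p" "le q s\<^sub>1"
  obtains r \<pi>\<^sub>2 s\<^sub>2 where "r \<in> P" "le r q" "(\<pi>\<^sub>2, s\<^sub>2) \<in> pairs \<tau>" "le r s\<^sub>2" "forces_eq P le \<pi>\<^sub>1 \<pi>\<^sub>2 r"
proof -
  have "dense_below P le p
        (\<lambda>q. le q s\<^sub>1 \<longrightarrow> (\<exists>(\<pi>\<^sub>2, s\<^sub>2) \<in> pairs \<tau>. le q s\<^sub>2 \<and> forces_eq P le \<pi>\<^sub>1 \<pi>\<^sub>2 q))"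
    using assms(1,2) unfolding forces_eq_iff[of _ _ \<sigma>] by blast
  then obtain r where "r \<in> P" "le r q"
    "le r s\<^sub>1 \<longrightarrow> (\<exists>(\<pi>\<^sub>2, s\<^sub>2) \<in> pairs \<tau>. le r s\<^sub>2 \<and> forces_eq P le \<pi>\<^sub>1 \<pi>\<^sub>2 r)"
    using assms(3,4) by (rule dense_belowE)
  then show ?thesis using le_trans[OF \<open>le r q\<close> assms(5)] that by blast
qed

lemma forces_eq_mono: "forces_eq P le \<sigma> \<tau> p \<Longrightarrow> le q p \<Longrightarrow> forces_eq P le \<sigma> \<tau> q"
  unfolding forces_eq_iff[of _ _ \<sigma>] using dense_below_mono by blast

lemma forces_mem_mono: "forces_mem P le \<sigma> \<tau> p \<Longrightarrow> le q p \<Longrightarrow> forces_mem P le \<sigma> \<tau> q"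
  unfolding forces_mem_def by (rule dense_below_mono)

lemma forces_eq_refl: "forces_eq P le \<sigma> \<sigma> p"
proof (induction \<sigma> arbitrary: p rule: name_pairs_induct)
  case (step \<sigma>)
  show ?case
    by (rule forces_eqI; rule dense_belowI) (use step le_refl in blast)+
qed

text \<open>The recursion is on the left name only, but exchanging the names in
  \<open>forces_eq_iff\<close> just swaps its two halves, up to the equalities between members,
  which the induction hypothesis reverses.\<close>

lemma forces_eq_sym: "forces_eq P le \<sigma> \<tau> p \<Longrightarrow> forces_eq P le \<tau> \<sigma> p"
proof (induction \<sigma> arbitrary: \<tau> p rule: name_pairs_induct)
  case (step \<sigma>)
  from step.prems have
    1: "\<forall>(\<pi>\<^sub>1, s\<^sub>1) \<in> pairs \<sigma>. dense_below P le p
        (\<lambda>q. le q s\<^sub>1 \<longrightarrow> (\<exists>(\<pi>\<^sub>2, s\<^sub>2) \<in> pairs \<tau>. le q s\<^sub>2 \<and> forces_eq P le \<pi>\<^sub>1 \<pi>\<^sub>2 q))" and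
    2: "\<forall>(\<pi>\<^sub>2, s\<^sub>2) \<in> pairs \<tau>. dense_below P le p
        (\<lambda>q. le q s\<^sub>2 \<longrightarrow> (\<exists>(\<pi>\<^sub>1, s\<^sub>1) \<in> pairs \<sigma>. le q s\<^sub>1 \<and> forces_eq P le \<pi>\<^sub>1 \<pi>\<^sub>2 q))"
    unfolding forces_eq_iff[of _ _ \<sigma>] by auto
  show ?case
  proof (rule forces_eqI; rule dense_belowI)
    fix \<pi> s r assume a: "(\<pi>, s) \<in> pairs \<tau>" "r \<in> P" "le r p"
    from 2 a(1) have "dense_below P le p
        (\<lambda>q. le q s \<longrightarrow> (\<exists>(\<pi>\<^sub>1, s\<^sub>1) \<in> pairs \<sigma>. le q s\<^sub>1 \<and> forces_eq P le \<pi>\<^sub>1 \<pi> q))" by blast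
    from this a(2,3) obtain q where "q \<in> P" "le q r"
      "le q s \<longrightarrow> (\<exists>(\<pi>\<^sub>1, s\<^sub>1) \<in> pairs \<sigma>. le q s\<^sub>1 \<and> forces_eq P le \<pi>\<^sub>1 \<pi> q)"
      by (rule dense_belowE)
    then show "\<exists>q \<in> P. le q r \<and> (le q s \<longrightarrow>
        (\<exists>(\<pi>\<^sub>2, s\<^sub>2) \<in> pairs \<sigma>. le q s\<^sub>2 \<and> forces_eq P le \<pi> \<pi>\<^sub>2 q))"
      using step.IH by blast
  next
    fix \<pi> s r assume a: "(\<pi>, s) \<in> pairs \<sigma>" "r \<in> P" "le r p"
    from 1 a(1) have "dense_below P le p
        (\<lambda>q. le q s \<longrightarrow> (\<exists>(\<pi>\<^sub>2, s\<^sub>2) \<in> pairs \<tau>. le q s\<^sub>2 \<and> forces_eq P le \<pi> \<pi>\<^sub>2 q))" by blast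
    from this a(2,3) obtain q where "q \<in> P" "le q r"
      "le q s \<longrightarrow> (\<exists>(\<pi>\<^sub>2, s\<^sub>2) \<in> pairs \<tau>. le q s\<^sub>2 \<and> forces_eq P le \<pi> \<pi>\<^sub>2 q)"
      by (rule dense_belowE)
    then show "\<exists>q \<in> P. le q r \<and> (le q s \<longrightarrow>
        (\<exists>(\<pi>\<^sub>1, s\<^sub>1) \<in> pairs \<tau>. le q s\<^sub>1 \<and> forces_eq P le \<pi>\<^sub>1 \<pi> q))"
      using step.IH a(1) by blast
  qed
qed

text \<open>Follow a member of \<sigma> into \<tau> and on into \<rho>, strengthening the condition
  each time. For the converse, walk from \<rho> back to \<sigma> by symmetry and apply the induction
  hypothesis to the member of \<sigma> where the walk ends.\<close>

lemma forces_eq_trans: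
  "forces_eq P le \<sigma> \<tau> p \<Longrightarrow> forces_eq P le \<tau> \<rho> p \<Longrightarrow> forces_eq P le \<sigma> \<rho> p"
proof (induction \<sigma> arbitrary: \<tau> \<rho> p rule: name_pairs_induct)
  case (step \<sigma>)
  show ?case
  proof (rule forces_eqI; rule dense_belowI)
    fix \<pi>\<^sub>1 s\<^sub>1 r assume a: "(\<pi>\<^sub>1, s\<^sub>1) \<in> pairs \<sigma>" "r \<in> P" "le r p"
    show "\<exists>q \<in> P. le q r \<and> (le q s\<^sub>1 \<longrightarrow>
        (\<exists>(\<pi>\<^sub>2, s\<^sub>2) \<in> pairs \<rho>. le q s\<^sub>2 \<and> forces_eq P le \<pi>\<^sub>1 \<pi>\<^sub>2 q))"
    proof (cases "le r s\<^sub>1")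
      case True
      obtain q \<pi>\<^sub>2 s\<^sub>2 where q: "q \<in> P" "le q r" "(\<pi>\<^sub>2, s\<^sub>2) \<in> pairs \<tau>" "le q s\<^sub>2"
        "forces_eq P le \<pi>\<^sub>1 \<pi>\<^sub>2 q"
        using forces_eq_left[OF step.prems(1) a True] .
      obtain q' \<pi>\<^sub>3 s\<^sub>3 where q': "q' \<in> P" "le q' q" "(\<pi>\<^sub>3, s\<^sub>3) \<in> pairs \<rho>" "le q' s\<^sub>3"
        "forces_eq P le \<pi>\<^sub>2 \<pi>\<^sub>3 q'"
        using forces_eq_left[OF step.prems(2) q(3,1) le_trans[OF q(2) a(3)] q(4)] .
      have "forces_eq P le \<pi>\<^sub>1 \<pi>\<^sub>3 q'"
        using step.IH[OF a(1) forces_eq_mono[OF q(5) q'(2)] q'(5)] .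
      then show ?thesis using q' q(2) le_trans by blast
    qed (use a le_refl in blast)
  next
    fix \<pi>\<^sub>3 s\<^sub>3 r assume a: "(\<pi>\<^sub>3, s\<^sub>3) \<in> pairs \<rho>" "r \<in> P" "le r p"
    show "\<exists>q \<in> P. le q r \<and> (le q s\<^sub>3 \<longrightarrow>
        (\<exists>(\<pi>\<^sub>1, s\<^sub>1) \<in> pairs \<sigma>. le q s\<^sub>1 \<and> forces_eq P le \<pi>\<^sub>1 \<pi>\<^sub>3 q))"
    proof (cases "le r s\<^sub>3")
      case True
      obtain q \<pi>\<^sub>2 s\<^sub>2 where q: "q \<in> P" "le q r" "(\<pi>\<^sub>2, s\<^sub>2) \<in> pairs \<tau>" "le q s\<^sub>2"
        "forces_eq P le \<pi>\<^sub>3 \<pi>\<^sub>2 q"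
        using forces_eq_left[OF forces_eq_sym[OF step.prems(2)] a True] .
      obtain q' \<pi>\<^sub>1 s\<^sub>1 where q': "q' \<in> P" "le q' q" "(\<pi>\<^sub>1, s\<^sub>1) \<in> pairs \<sigma>" "le q' s\<^sub>1"
        "forces_eq P le \<pi>\<^sub>2 \<pi>\<^sub>1 q'"
        using forces_eq_left[OF forces_eq_sym[OF step.prems(1)] q(3,1) le_trans[OF q(2) a(3)] q(4)] .
      have "forces_eq P le \<pi>\<^sub>1 \<pi>\<^sub>3 q'"
        using step.IH[OF q'(3) forces_eq_sym[OF q'(5)] forces_eq_sym[OF forces_eq_mono[OF q(5) q'(2)]]] .
      then show ?thesis using q' q(2) le_trans by blast
    qed (use a le_refl in blast)
  qed
qed

lemma forces_mem_cong:
  assumes "forces_eq P le \<sigma> \<sigma>' p" "forces_mem P le \<sigma> \<tau> p"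
  shows "forces_mem P le \<sigma>' \<tau> p"
  unfolding forces_mem_def
proof (rule dense_belowI)
  fix r assume r: "r \<in> P" "le r p"
  obtain q \<pi> u where q: "q \<in> P" "le q r" "(\<pi>, u) \<in> pairs \<tau>" "le q u" "forces_eq P le \<sigma> \<pi> q"
    using assms(2)[unfolded forces_mem_def] r by (rule dense_belowE) blast
  have "forces_eq P le \<sigma>' \<pi> q"
    using forces_eq_trans[OF forces_eq_sym q(5)] forces_eq_mono[OF assms(1)] q(2) r(2) le_trans by blast
  then show "\<exists>q \<in> P. le q r \<and> (\<exists>(\<pi>, u) \<in> pairs \<tau>. le q u \<and> forces_eq P le \<sigma>' \<pi> q)"
    using q by blast
qed

lemma forces_mem_pairs:
  assumes "(\<sigma>, u) \<in> pairs \<tau>" "le p u"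
  shows "forces_mem P le \<sigma> \<tau> p"
  unfolding forces_mem_def
  by (rule dense_belowI) (use assms forces_eq_refl le_refl le_trans in blast)

text \<open>When the matching pairs carry conditions above \<open>p\<close>, as in
  \<open>op_name\<close>, equality can be checked member by member at \<open>p\<close> itself,
  without a density argument.\<close>

lemma forces_eq_pairsI:
  assumes "\<And>\<pi> s. (\<pi>, s) \<in> pairs \<sigma> \<Longrightarrow> \<exists>\<pi>' s'. (\<pi>', s') \<in> pairs \<tau> \<and> le p s' \<and> forces_eq P le \<pi> \<pi>' p"
    and "\<And>\<pi> s. (\<pi>, s) \<in> pairs \<tau> \<Longrightarrow> \<exists>\<pi>' s'. (\<pi>', s') \<in> pairs \<sigma> \<and> le p s' \<and> forces_eq P le \<pi>' \<pi> p"
  shows "forces_eq P le \<sigma> \<tau> p"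
proof (rule forces_eqI; rule dense_belowI)
  fix \<pi> s r assume "(\<pi>, s) \<in> pairs \<sigma>" "r \<in> P" "le r p"
  moreover from this assms(1) obtain \<pi>' s' where
    "(\<pi>', s') \<in> pairs \<tau>" "le p s'" "forces_eq P le \<pi> \<pi>' p" by blast
  ultimately show "\<exists>q \<in> P. le q r \<and> (le q s \<longrightarrow>
      (\<exists>(\<pi>\<^sub>2, s\<^sub>2) \<in> pairs \<tau>. le q s\<^sub>2 \<and> forces_eq P le \<pi> \<pi>\<^sub>2 q))"
    using forces_eq_mono le_refl le_trans by blast
next
  fix \<pi> s r assume "(\<pi>, s) \<in> pairs \<tau>" "r \<in> P" "le r p"
  moreover from this assms(2) obtain \<pi>' s' where
    "(\<pi>', s') \<in> pairs \<sigma>" "le p s'" "forces_eq P le \<pi>' \<pi> p" by blast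
  ultimately show "\<exists>q \<in> P. le q r \<and> (le q s \<longrightarrow>
      (\<exists>(\<pi>\<^sub>1, s\<^sub>1) \<in> pairs \<sigma>. le q s\<^sub>1 \<and> forces_eq P le \<pi>\<^sub>1 \<pi> q))"
    using forces_eq_mono le_refl le_trans by blast
qed

section \<open>Forced quantifiers and implications\<close>

text \<open>\<open>All\<close> abbreviates a negated existential of a negation, so unfolding it
  gives the instance only at some extension \<open>r\<close>. That is enough where conditions are
  strengthened step by step anyway.\<close>

lemma forces_All_inst:
  assumes "forces P le p (All F)" "q \<in> P" "le q p" "is_name P \<sigma>"
  obtains r where "r \<in> P" "le r q" "forces P le r (F \<sigma>)"
proof -
  have "\<not> dense_below P le q (\<lambda>r. \<exists>\<sigma>. is_name P \<sigma> \<and> (\<forall>s \<in> P. le s r \<longrightarrow> \<not> forces P le s (F \<sigma>)))"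
    using assms(1-3) by simp
  then obtain r where r: "r \<in> P" "le r q"
    "\<And>s. s \<in> P \<Longrightarrow> le s r \<Longrightarrow> \<exists>t \<in> P. le t s \<and> forces P le t (F \<sigma>)"
    using assms(4) unfolding dense_below_def by blast
  from r(3)[OF r(1) le_refl] show ?thesis
    using that le_trans[OF _ r(2)] by blast
qed

lemma forces_Imp_mp:
  assumes "forces P le p (\<phi> \<^bold>\<longrightarrow> \<psi>)" "p \<in> P" "forces P le p \<phi>"
  obtains r where "r \<in> P" "le r p" "forces P le r \<psi>"
proof -
  have "\<exists>r \<in> P. le r p \<and> forces P le r \<psi>"
    using assms(1)[unfolded forces.simps, rule_format, OF assms(2) le_refl] assms(3) by auto
  then show ?thesis
    using that by blast
qed

lemma forces_Ex_witness:
  assumes "forces P le p (Ex F)" "p \<in> P"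
  obtains r \<sigma> where "r \<in> P" "le r p" "is_name P \<sigma>" "forces P le r (F \<sigma>)"
  using assms(1)[unfolded forces.simps] assms(2) le_refl by (rule dense_belowE) (use that in blast)

lemma forces_ExI:
  assumes "\<And>r. r \<in> P \<Longrightarrow> le r p \<Longrightarrow> \<exists>q \<in> P. le q r \<and> (\<exists>\<sigma>. is_name P \<sigma> \<and> forces P le q (F \<sigma>))"
  shows "forces P le p (Ex F)"
  using assms unfolding forces.simps by (rule dense_belowI)

end


section \<open>Check names and pairs\<close>

lemma card_of_finite_ordLeq:
  assumes "finite A" "infinite (UNIV :: 'i set)"
  shows "|A| \<le>o |UNIV :: 'i set|"
  using assms ordLeq_total[OF card_of_Well_order card_of_Well_order] card_of_ordLeq_finite by blast

lemma is_name_iff_pairs: "is_name P \<sigma> \<longleftrightarrow> (\<forall>(\<pi>, s) \<in> pairs \<sigma>. is_name P \<pi> \<and> s \<in> P)"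
  by (cases \<sigma>) auto

lemma pairs_mk_name_finite:
  fixes A :: "(('p, 'i) name \<times> 'p) set"
  assumes "finite A" "infinite (UNIV :: 'i set)"
  shows "pairs (mk_name A) = A"
  using assms by (intro pairs_mk_name card_of_finite_ordLeq)

text \<open>The image is no larger than the source type, so a single bound on that type makes
  \<open>mk_name\<close> meaningful for all check names over it.\<close>

lemma pairs_mk_name_image:
  fixes h :: "'a \<Rightarrow> ('p, 'i) name \<times> 'p"
  assumes "|UNIV :: 'a set| \<le>o |UNIV :: 'i set|"
  shows "pairs (mk_name (h ` A)) = h ` A"
  using ordLeq_transitive[OF ordLeq_transitive[OF card_of_image card_of_mono1[OF subset_UNIV]] assms]
  by (rule pairs_mk_name)

lemma pairs_check_set:
  fixes A :: "'a::wellorder set"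
  assumes "|UNIV :: 'a set| \<le>o |UNIV :: 'i set|"
  shows "pairs (check_set one A :: ('p, 'i) name) = (\<lambda>a. (check_ord one a, one)) ` A"
  unfolding check_set_def using assms by (rule pairs_mk_name_image)

lemma is_name_check_ord:
  fixes a :: "'a::wellorder"
  assumes "|UNIV :: 'a set| \<le>o |UNIV :: 'i set|" "one \<in> P"
  shows "is_name P (check_ord one a :: ('p, 'i) name)"
proof (induction a rule: less_induct)
  case (less a)
  have "pairs (check_ord one a :: ('p, 'i) name) = (\<lambda>b. (check_ord one b, one)) ` {..<a}"
    unfolding check_ord.simps[of one a] using assms(1) by (rule pairs_mk_name_image)
  then show ?case using less assms(2) by (subst is_name_iff_pairs) auto
qed

lemma is_name_check_set:
  fixes A :: "'a::wellorder set"
  assumes "|UNIV :: 'a set| \<le>o |UNIV :: 'i set|" "one \<in> P"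
  shows "is_name P (check_set one A :: ('p, 'i) name)"
  using assms by (subst is_name_iff_pairs) (auto simp: pairs_check_set is_name_check_ord)

lemma pairs_check_fun:
  assumes "infinite (UNIV :: 'i set)"
  shows "pairs (check_fun one f :: ('p, 'i) name) =
    range (\<lambda>n. (op_name one (check_ord one n) (check_set one (f n)), one))"
  unfolding check_fun_def
  using infinite_iff_card_of_nat[THEN iffD1, OF assms] by (rule pairs_mk_name_image)

lemma pairs_op_name:
  assumes "infinite (UNIV :: 'i set)"
  shows "pairs (op_name one \<sigma> \<tau> :: ('p, 'i) name) =
    {(mk_name {(\<sigma>, one)}, one), (mk_name {(\<sigma>, one), (\<tau>, one)}, one)}"
  unfolding op_name_def by (rule pairs_mk_name_finite) (use assms in auto)

lemma is_name_op_name: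
  assumes "infinite (UNIV :: 'i set)" "one \<in> P" "is_name P \<sigma>" "is_name P (\<tau> :: ('p, 'i) name)"
  shows "is_name P (op_name one \<sigma> \<tau>)"
proof -
  have "is_name P (mk_name {(\<sigma>, one)})" "is_name P (mk_name {(\<sigma>, one), (\<tau>, one)})"
    using assms by (subst is_name_iff_pairs; simp add: pairs_mk_name_finite)+
  then show ?thesis
    using assms(2) by (subst is_name_iff_pairs) (auto simp: pairs_op_name[OF assms(1)])
qed

section \<open>Pairs and values under forcing\<close>

context forcing_preorder
begin

lemma forces_eq_op_name_cong:
  fixes \<sigma> \<sigma>' \<tau> \<tau>' :: "('p, 'i) name"
  assumes inf: "infinite (UNIV :: 'i set)" and "le p one"
    and "forces_eq P le \<sigma> \<sigma>' p" "forces_eq P le \<tau> \<tau>' p"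
  shows "forces_eq P le (op_name one \<sigma> \<tau>) (op_name one \<sigma>' \<tau>') p"
proof -
  have "forces_eq P le (mk_name {(\<sigma>, one)}) (mk_name {(\<sigma>', one)}) p"
    "forces_eq P le (mk_name {(\<sigma>, one), (\<tau>, one)}) (mk_name {(\<sigma>', one), (\<tau>', one)}) p"
    using assms by (intro forces_eq_pairsI; auto simp: pairs_mk_name_finite)+
  then show ?thesis
    using assms by (intro forces_eq_pairsI) (auto simp: pairs_op_name)
qed

text \<open>The singleton of \<sigma>' belongs to the second pair, so it equals a member of the
  first. Both members of the first pair contain \<sigma>, hence \<sigma> equals the only element of
  the singleton, whichever member it was.\<close>

lemma forces_eq_op_name_fst:
  fixes \<sigma> \<sigma>' \<tau> \<tau>' :: "('p, 'i) name"
  assumes inf: "infinite (UNIV :: 'i set)" and p: "p \<in> P" "le p one"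
    and eq: "forces_eq P le (op_name one \<sigma> \<tau>) (op_name one \<sigma>' \<tau>') p"
  obtains q where "q \<in> P" "le q p" "forces_eq P le \<sigma> \<sigma>' q"
proof -
  have "(mk_name {(\<sigma>', one)}, one) \<in> pairs (op_name one \<sigma>' \<tau>')"
    by (simp add: pairs_op_name[OF inf])
  from forces_eq_left[OF forces_eq_sym[OF eq] this p(1) le_refl p(2)]
  obtain r \<pi> u where r: "r \<in> P" "le r p" "(\<pi>, u) \<in> pairs (op_name one \<sigma> \<tau>)"
    "forces_eq P le (mk_name {(\<sigma>', one)}) \<pi> r" .
  have "(\<sigma>, one) \<in> pairs \<pi>"
    using r(3) by (auto simp: pairs_op_name[OF inf] pairs_mk_name_finite[OF _ inf])
  from forces_eq_left[OF forces_eq_sym[OF r(4)] this r(1) le_refl le_trans[OF r(2) p(2)]]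
  obtain q \<pi>' u' where q: "q \<in> P" "le q r" "(\<pi>', u') \<in> pairs (mk_name {(\<sigma>', one)})"
    "forces_eq P le \<sigma> \<pi>' q" .
  then show ?thesis
    using that le_trans[OF q(2) r(2)] by (auto simp: pairs_mk_name_finite[OF _ inf])
qed

lemma forces_mem_check_set:
  fixes A :: "'a::wellorder set" and \<sigma> :: "('p, 'i) name"
  assumes "|UNIV :: 'a set| \<le>o |UNIV :: 'i set|"
    and "forces_mem P le \<sigma> (check_set one A) p" "p \<in> P"
  obtains q a where "q \<in> P" "le q p" "a \<in> A" "forces_eq P le \<sigma> (check_ord one a) q"
  using assms(2)[unfolded forces_mem_def pairs_check_set[OF assms(1)]] assms(3) le_refl
  by (rule dense_belowE) (use that in auto)

text \<open>Walk through the formula saying that \<open>g\<close> is a function, strengthening the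
  condition at each connective: first find a name \<open>y\<close> for the value at
  \<open>n\<close>, then locate the pair of \<open>n\<close> and \<open>y\<close> in the product of
  domain and range.\<close>

lemma decide_value:
  fixes g :: "('p, 'i) name" and n :: nat
  assumes inf: "infinite (UNIV :: 'i set)"
    and card: "|UNIV :: 'l::wellorder set| \<le>o |UNIV :: 'i set|"
    and one: "one \<in> P" "\<And>q. q \<in> P \<Longrightarrow> le q one"
    and fn: "forces P le p (is_fun_fm one g (check_set one (UNIV :: nat set))
               (check_set one (UNIV :: 'l::wellorder set)))"
    and q: "q \<in> P" "le q p"
  obtains r and v :: "'l::wellorder" where "r \<in> P" "le r q"
    "forces_mem P le (op_name one (check_ord one n) (check_ord one v)) g r"
proof -
  let ?n = "check_ord one n :: ('p, 'i) name"
  have nat: "|UNIV :: nat set| \<le>o |UNIV :: 'i set|"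
    using infinite_iff_card_of_nat[THEN iffD1, OF inf] .
  note n_name = is_name_check_ord[OF nat one(1), of n]
  have n_mem: "forces_mem P le ?n (check_set one (UNIV :: nat set)) r" if "r \<in> P" for r
    by (rule forces_mem_pairs[of _ one]) (auto simp: pairs_check_set[OF nat] one(2) that)
  note fn = fn[unfolded is_fun_fm_def forces.simps(4)]
  obtain q1 where q1: "q1 \<in> P" "le q1 q" "forces P le q1
     (?n \<^bold>\<in> check_set one (UNIV :: nat set) \<^bold>\<longrightarrow>
        (\<^bold>\<exists>y. op_name one ?n y \<^bold>\<in> g \<^bold>\<and> (\<^bold>\<forall>y'. op_name one ?n y' \<^bold>\<in> g \<^bold>\<longrightarrow> y' \<^bold>= y)))"
    using forces_All_inst[OF conjunct2[OF fn] q n_name] .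
  obtain q2 where q2: "q2 \<in> P" "le q2 q1" "forces P le q2
     (\<^bold>\<exists>y. op_name one ?n y \<^bold>\<in> g \<^bold>\<and> (\<^bold>\<forall>y'. op_name one ?n y' \<^bold>\<in> g \<^bold>\<longrightarrow> y' \<^bold>= y))"
    using forces_Imp_mp[OF q1(3,1) iffD2[OF forces.simps(1) n_mem[OF q1(1)]]] .
  obtain q3 y where q3: "q3 \<in> P" "le q3 q2" "is_name P y" "forces P le q3
     (op_name one ?n y \<^bold>\<in> g \<^bold>\<and> (\<^bold>\<forall>y'. op_name one ?n y' \<^bold>\<in> g \<^bold>\<longrightarrow> y' \<^bold>= y))"
    using forces_Ex_witness[OF q2(3,1)] .
  have y: "forces_mem P le (op_name one ?n y) g q3"
    using q3(4) by simp
  have q3q: "le q3 q" using q1(2) q2(2) q3(2) le_trans by blast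
  obtain q4 where q4: "q4 \<in> P" "le q4 q3" "forces P le q4 (op_name one ?n y \<^bold>\<in> g \<^bold>\<longrightarrow>
      (\<^bold>\<exists>x. x \<^bold>\<in> check_set one (UNIV :: nat set) \<^bold>\<and>
        (\<^bold>\<exists>y'. y' \<^bold>\<in> check_set one (UNIV :: 'l set) \<^bold>\<and> op_name one ?n y \<^bold>= op_name one x y')))"
    using forces_All_inst[OF conjunct1[OF fn] q3(1) le_trans[OF q3q q(2)]
        is_name_op_name[OF inf one(1) n_name q3(3)]] .
  obtain q5 where q5: "q5 \<in> P" "le q5 q4" "forces P le q5
      (\<^bold>\<exists>x. x \<^bold>\<in> check_set one (UNIV :: nat set) \<^bold>\<and>
        (\<^bold>\<exists>y'. y' \<^bold>\<in> check_set one (UNIV :: 'l set) \<^bold>\<and> op_name one ?n y \<^bold>= op_name one x y'))"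
    using forces_Imp_mp[OF q4(3,1) iffD2[OF forces.simps(1) forces_mem_mono[OF y q4(2)]]] .
  obtain q6 x where q6: "q6 \<in> P" "le q6 q5" "forces P le q6
      (x \<^bold>\<in> check_set one (UNIV :: nat set) \<^bold>\<and>
        (\<^bold>\<exists>y'. y' \<^bold>\<in> check_set one (UNIV :: 'l set) \<^bold>\<and> op_name one ?n y \<^bold>= op_name one x y'))"
    using forces_Ex_witness[OF q5(3,1)] .
  obtain q7 y' where q7: "q7 \<in> P" "le q7 q6" "forces P le q7
      (y' \<^bold>\<in> check_set one (UNIV :: 'l set) \<^bold>\<and> op_name one ?n y \<^bold>= op_name one x y')"
    using forces_Ex_witness[OF conjunct2[OF q6(3)[unfolded forces.simps(4)]] q6(1)] .
  then have y': "forces_mem P le y' (check_set one (UNIV :: 'l set)) q7"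
    and eq: "forces_eq P le (op_name one ?n y) (op_name one x y') q7"
    by auto
  obtain q8 and v :: 'l where q8: "q8 \<in> P" "le q8 q7" "forces_eq P le y' (check_ord one v) q8"
    using forces_mem_check_set[OF card y' q7(1)] .
  obtain r where r: "r \<in> P" "le r q8" "forces_eq P le ?n x r"
    using forces_eq_op_name_fst[OF inf q8(1) one(2)[OF q8(1)] forces_eq_mono[OF eq q8(2)]] .
  \<comment> \<open>The second coordinates \<open>y\<close> and \<open>y'\<close> are never
    compared: \<open>op_name one x y'\<close> is rewritten coordinatewise to the desired pair, and
    it equals the pair known to be in \<open>g\<close>.\<close>
  have "le r q3" "le r q7"
    using r(2) q8(2) q7(2) q6(2) q5(2) q4(2) le_trans by blast+
  have "forces_eq P le (op_name one x y') (op_name one ?n (check_ord one v)) r"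
    using forces_eq_op_name_cong[OF inf one(2)[OF r(1)] forces_eq_sym[OF r(3)]
        forces_eq_mono[OF q8(3) r(2)]] .
  with forces_eq_mono[OF eq \<open>le r q7\<close>]
  have "forces_eq P le (op_name one ?n y) (op_name one ?n (check_ord one v)) r"
    by (rule forces_eq_trans)
  then have "forces_mem P le (op_name one ?n (check_ord one v)) g r"
    using forces_mem_mono[OF y \<open>le r q3\<close>] by (rule forces_mem_cong)
  then show ?thesis
    using that r(1) le_trans[OF \<open>le r q3\<close> q3q] by blast
qed

text \<open>The witnesses are the check names of a value \<open>v\<close> and of \<open>f n\<close>.
  Since existentials are forced once witnesses occur densely, different extensions may use different
  \<open>v\<close>.\<close>

lemma forces_app_mem_appI:
  fixes g :: "('p, 'i) name" and f :: "nat \<Rightarrow> 'l::wellorder set"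
  assumes inf: "infinite (UNIV :: 'i set)"
    and card: "|UNIV :: 'l set| \<le>o |UNIV :: 'i set|"
    and one: "one \<in> P" "\<And>q. q \<in> P \<Longrightarrow> le q one"
    and dense: "\<And>r. r \<in> P \<Longrightarrow> le r p \<Longrightarrow> \<exists>q \<in> P. le q r \<and> (\<exists>v \<in> f n.
      forces_mem P le (op_name one (check_ord one n) (check_ord one v)) g q)"
  shows "forces P le p (app_mem_app_fm one g (check_fun one f) (check_ord one n))"
  unfolding app_mem_app_fm_def
proof (rule forces_ExI)
  fix r assume "r \<in> P" "le r p"
  then obtain q v where q: "q \<in> P" "le q r" and v: "v \<in> f n"
    and mem: "forces_mem P le (op_name one (check_ord one n) (check_ord one v)) g q"
    using dense by blast
  let ?n = "check_ord one n :: ('p, 'i) name" and ?v = "check_ord one v :: ('p, 'i) name"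
  let ?A = "check_set one (f n) :: ('p, 'i) name"
  have "forces P le q (\<^bold>\<exists>z. op_name one ?n ?v \<^bold>\<in> g \<^bold>\<and> op_name one ?n z \<^bold>\<in> check_fun one f \<^bold>\<and> ?v \<^bold>\<in> z)"
  proof (rule forces_ExI)
    fix s assume s: "s \<in> P" "le s q"
    have "forces_mem P le (op_name one ?n ?A) (check_fun one f) s"
      by (rule forces_mem_pairs[of _ one], subst pairs_check_fun[OF inf]) (use one(2)[OF s(1)] in blast)+
    moreover have "forces_mem P le ?v ?A s"
      using one(2)[OF s(1)] v by (intro forces_mem_pairs[of _ one]) (auto simp: pairs_check_set[OF card])
    ultimately have "forces P le s
      (op_name one ?n ?v \<^bold>\<in> g \<^bold>\<and> op_name one ?n ?A \<^bold>\<in> check_fun one f \<^bold>\<and> ?v \<^bold>\<in> ?A)"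
      using forces_mem_mono[OF mem s(2)] by simp
    then show "\<exists>q \<in> P. le q s \<and> (\<exists>z. is_name P z \<and> forces P le q
      (op_name one ?n ?v \<^bold>\<in> g \<^bold>\<and> op_name one ?n z \<^bold>\<in> check_fun one f \<^bold>\<and> ?v \<^bold>\<in> z))"
      using s(1) le_refl is_name_check_set[OF card one(1)] by blast
  qed
  then show "\<exists>q \<in> P. le q r \<and> (\<exists>y. is_name P y \<and> forces P le q
    (\<^bold>\<exists>z. op_name one ?n y \<^bold>\<in> g \<^bold>\<and> op_name one ?n z \<^bold>\<in> check_fun one f \<^bold>\<and> y \<^bold>\<in> z))"
    using q is_name_check_ord[OF card one(1)] by blast
qed

end

section \<open>Perfect trees\<close>

text \<open>The initial segments of \<open>c\<close> are kept to make the restriction closed under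
  initial segments.\<close>

definition tree_at :: "'k list set \<Rightarrow> 'k list \<Rightarrow> 'k list set" where
  "tree_at T c = {t \<in> T. prefix t c \<or> prefix c t}"

lemma is_treeD: "is_tree kap T \<Longrightarrow> t \<in> T \<Longrightarrow> prefix s t \<Longrightarrow> s \<in> T"
  unfolding is_tree_def by blast

lemma Nil_in_tree: "is_tree kap T \<Longrightarrow> T \<noteq> {} \<Longrightarrow> [] \<in> T"
  unfolding is_tree_def by auto

lemma prefix_restr: "n \<le> m \<Longrightarrow> prefix (restr f n) (restr f m)"
  unfolding restr_def using upt_add_eq_append[of 0 n "m - n"] by simp

lemma length_restr [simp]: "length (restr f n) = n"
  unfolding restr_def by simp

text \<open>A tree without maximal nodes allows one-point extensions to be chosen forever; the
  branch is the union of the resulting chain \<open>U\<close>.\<close>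

lemma tree_branch_through:
  assumes "is_tree kap T" "t \<in> T" "\<And>t. t \<in> T \<Longrightarrow> \<exists>u \<in> T. strict_prefix t u"
  shows "\<exists>f \<in> branches kap T. restr f (length t) = t"
proof -
  have "\<exists>a. u @ [a] \<in> T" if u: "u \<in> T" for u
  proof -
    obtain v where v: "v \<in> T" "strict_prefix u v"
      using assms(3)[OF u] by blast
    then obtain a w where "v = u @ a # w"
      by (auto elim: strict_prefixE')
    then show ?thesis
      using is_treeD[OF assms(1) v(1), of "u @ [a]"] by auto
  qed
  then obtain nxt where nxt: "\<And>u. u \<in> T \<Longrightarrow> u @ [nxt u] \<in> T"
    by metis
  define U where "U = rec_nat t (\<lambda>_ u. u @ [nxt u])"
  have U_simps: "U 0 = t" "\<And>n. U (Suc n) = U n @ [nxt (U n)]"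
    unfolding U_def by simp_all
  have U_T: "U n \<in> T" for n
    by (induction n) (auto simp: U_simps assms(2) nxt)
  have U_len: "length (U n) = length t + n" for n
    by (induction n) (auto simp: U_simps)
  have U_prefix: "prefix (U m) (U (m + i))" for m i
    by (induction i) (auto simp: U_simps intro: prefix_order.trans)
  \<comment> \<open>\<open>U (Suc i)\<close> has length at least \<open>Suc i\<close>, so the index
    \<open>i\<close> is in range; all other long enough members of the chain agree with it
    there.\<close>
  define f where "f i = U (Suc i) ! i" for i
  have U_nth: "U n ! i = f i" if "i < length (U n)" for n i
  proof (cases "n \<le> Suc i")
    case True
    have "prefix (U n) (U (Suc i))"
      using U_prefix[of n "Suc i - n"] True by simp
    then show ?thesis
      using that unfolding f_def prefix_def by (auto simp: nth_append)
  next
    case False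
    have "prefix (U (Suc i)) (U n)"
      using U_prefix[of "Suc i" "n - Suc i"] False by simp
    moreover have "i < length (U (Suc i))"
      by (simp add: U_len)
    ultimately show ?thesis
      unfolding f_def prefix_def by (auto simp: nth_append)
  qed
  have restr_U: "restr f (length (U n)) = U n" for n
    by (rule nth_equalityI) (auto simp: U_nth restr_def)
  have restr_T: "restr f n \<in> T" for n
  proof -
    have "prefix (restr f n) (U n)"
      using prefix_restr[of n "length (U n)" f] by (simp add: restr_U, simp add: U_len)
    then show ?thesis
      using is_treeD[OF assms(1) U_T] by blast
  qed
  moreover have "f i < kap i" for i
  proof -
    have "restr f (Suc i) ! i < kap i"
      using assms(1) restr_T[of "Suc i"] unfolding is_tree_def seqs_def
      by (auto simp del: upt_Suc)
    then show ?thesis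
      by (simp add: restr_def del: upt_Suc)
  qed
  ultimately have "f \<in> branches kap T"
    unfolding branches_def full_seqs_def by blast
  then show ?thesis
    using restr_U[of 0] by (auto simp: U_simps)
qed

lemma Field_seg: "Field (seg a) = {..<a}"
  unfolding seg_def Field_def by force

lemma Well_order_seg: "Well_order (seg (a::'a::wellorder))"
proof -
  have "wf (seg a - Id)"
    by (rule wf_subset[OF wf, of "seg a - Id"]) (auto simp: seg_def)
  then show ?thesis
    unfolding well_order_on_def linear_order_on_def partial_order_on_def preorder_on_def Field_seg
    by (auto simp: seg_def refl_on_def trans_def antisym_def total_on_def)
qed

lemma card_of_lessThan_le_seg: "|{..<a}| \<le>o seg (a::'a::wellorder)"
  using card_of_least[OF Well_order_seg[of a]] by (simp add: Field_seg)

section \<open>Building and restricting perfect trees\<close>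

context singular_setting
begin

lemma seg_kap_ordIso: "|{..<kap n}| =o seg (kap n)"
  using card_of_Field_ordIso[of "seg (kap n)"] kap_regular[of n] by (simp add: Field_seg)

lemma seg_kap_le_iff: "seg (kap n) \<le>o |A| \<longleftrightarrow> |{..<kap n}| \<le>o |A|"
  using seg_kap_ordIso[of n] ordIso_ordLeq_trans ordIso_symmetric by blast

lemma infinite_lessThan_kap: "infinite {..<kap n}"
proof
  assume "finite {..<kap n}"
  then have "|{..<kap n}| <o natLeq"
    by (simp add: finite_iff_ordLess_natLeq)
  then have "natLeq <o natLeq"
    using kap_uncountable[of n] seg_kap_ordIso[of n]
      ordIso_ordLess_trans ordIso_symmetric ordLess_transitive by blast
  then show False
    using ordLess_irreflexive by blast
qed

text \<open>The branch condition follows from splitting: a node with infinitely many successors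
  above \<open>t\<close> yields a proper extension of \<open>t\<close>, so
  \<open>tree_branch_through\<close> applies.\<close>

lemma perfect_treeI:
  assumes "is_tree kap T" "T \<noteq> {}"
    and split: "\<And>n t. t \<in> T \<Longrightarrow> \<exists>t' \<in> T. prefix t t' \<and> |{..<kap n}| \<le>o |Succs T t'|"
  shows "T \<in> perfect_trees kap"
proof -
  have "\<exists>u \<in> T. strict_prefix t u" if t: "t \<in> T" for t
  proof -
    obtain t' where t': "prefix t t'" "|{..<kap 0}| \<le>o |Succs T t'|"
      using split[OF t] by blast
    have "Succs T t' \<noteq> {}"
      using t'(2) infinite_lessThan_kap[of 0] by (metis card_of_ordLeq_infinite finite.emptyI)
    then obtain a where "t' @ [a] \<in> T"
      unfolding Succs_def by blast
    moreover have "strict_prefix t (t' @ [a])"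
      using t'(1) by (simp add: prefix_snoc strict_prefix_def) auto
    ultimately show ?thesis by blast
  qed
  then show ?thesis
    using assms tree_branch_through[OF assms(1)]
    unfolding perfect_trees_def perfect_tree_def seg_kap_le_iff by blast
qed

lemma perfect_treesD:
  assumes "T \<in> perfect_trees kap"
  shows "is_tree kap T" "[] \<in> T"
  using assms Nil_in_tree unfolding perfect_trees_def perfect_tree_def by auto

lemma perfect_tree_extend:
  assumes "T \<in> perfect_trees kap" "t \<in> T"
  obtains u where "u \<in> T" "prefix t u" "m \<le> length u"
proof -
  obtain f where f: "f \<in> branches kap T" "restr f (length t) = t"
    using assms unfolding perfect_trees_def perfect_tree_def by blast
  show ?thesis
  proof (rule that)
    show "restr f (length t + m) \<in> T"
      using f(1) unfolding branches_def by blast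
    show "prefix t (restr f (length t + m))"
      using prefix_restr[of "length t" "length t + m" f] f(2) by simp
  qed simp
qed

lemma perfect_tree_split:
  assumes "T \<in> perfect_trees kap" "t \<in> T"
  obtains u where "u \<in> T" "prefix t u" "|{..<kap n}| \<le>o |Succs T u|"
  using assms unfolding perfect_trees_def perfect_tree_def seg_kap_le_iff by blast

text \<open>Nothing above \<open>c\<close> is removed, so a splitting node found above both
  \<open>t\<close> and \<open>c\<close> keeps all its successors.\<close>

lemma perfect_tree_at:
  assumes "T \<in> perfect_trees kap" "c \<in> T"
  shows "tree_at T c \<in> perfect_trees kap"
proof (rule perfect_treeI)
  have T: "is_tree kap T"
    using assms(1) by (rule perfect_treesD)
  show "is_tree kap (tree_at T c)"
    using T unfolding is_tree_def tree_at_def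
    by (auto dest: prefix_same_cases prefix_order.trans)
  show "tree_at T c \<noteq> {}"
    using assms(2) unfolding tree_at_def by blast
  fix n t assume "t \<in> tree_at T c"
  then obtain u where u: "u \<in> T" "prefix t u" "prefix c u"
    using assms(2) unfolding tree_at_def by blast
  obtain t' where t': "t' \<in> T" "prefix u t'" "|{..<kap n}| \<le>o |Succs T t'|"
    using perfect_tree_split[OF assms(1) u(1)] .
  have "prefix c t'" "prefix t t'"
    using u t' by (auto intro: prefix_order.trans)
  then have "Succs (tree_at T c) t' = Succs T t'" "t' \<in> tree_at T c"
    using t'(1) unfolding Succs_def tree_at_def by auto
  then show "\<exists>t' \<in> tree_at T c. prefix t t' \<and> |{..<kap n}| \<le>o |Succs (tree_at T c) t'|"
    using t'(3) \<open>prefix t t'\<close> by (intro bexI[of _ t']) auto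
qed

text \<open>\<open>S\<close> has a node longer than \<open>c\<close>, and being comparable with
  \<open>c\<close> it must extend \<open>c\<close>. Thus shrinking a condition during the fusion
  never loses its stem.\<close>

lemma stem_in_subtree:
  assumes "S \<in> perfect_trees kap" "S \<subseteq> tree_at T c"
  shows "c \<in> S"
proof -
  obtain u where u: "u \<in> S" "Suc (length c) \<le> length u"
    using perfect_tree_extend[OF assms(1) perfect_treesD(2)[OF assms(1)]] .
  have "\<not> prefix u c"
    using u(2) prefix_length_le by fastforce
  then have "prefix c u"
    using u(1) assms(2) unfolding tree_at_def by blast
  then show ?thesis
    using is_treeD[OF perfect_treesD(1)[OF assms(1)] u(1)] by blast
qed

text \<open>A node of length at least \<open>n\<close> can be extended by every ordinal below
  \<open>kap n\<close>, as \<open>kap\<close> is increasing.\<close>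

lemma seqs_perfect: "seqs kap \<in> perfect_trees kap"
proof (rule perfect_treeI)
  show "is_tree kap (seqs kap)"
    unfolding is_tree_def
  proof (intro conjI ballI allI impI subset_refl)
    fix t s assume t: "t \<in> seqs kap" "prefix s t"
    then obtain u where u: "t = s @ u"
      by (elim prefixE)
    have "s ! i < kap i" if "i < length s" for i
    proof -
      have "t ! i < kap i"
        using t(1) that unfolding seqs_def u by simp
      then show ?thesis
        using that by (simp add: u nth_append)
    qed
    then show "s \<in> seqs kap"
      by (simp add: seqs_def)
  qed
  have "[] \<in> seqs kap"
    by (simp add: seqs_def)
  then show "seqs kap \<noteq> {}" by blast
  have pos: "\<exists>a. a < kap i" for i
    using infinite_lessThan_kap[of i] by (metis finite.emptyI lessThan_iff equals0I)
  fix n t assume t: "t \<in> seqs kap"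
  have "\<exists>t' \<in> seqs kap. prefix t t' \<and> length t' = length t + m" for m
  proof (induction m)
    case 0
    show ?case using t by (intro bexI[of _ t]) auto
  next
    case (Suc m)
    then obtain t' a where "t' \<in> seqs kap" "prefix t t'" "length t' = length t + m" "a < kap (length t')"
      using pos by blast
    then show ?case
      by (intro bexI[of _ "t' @ [a]"]) (auto simp: seqs_def nth_append less_Suc_eq)
  qed
  from this[of n] obtain t' where t': "t' \<in> seqs kap" "prefix t t'" "n \<le> length t'"
    by auto
  have "(\<lambda>a. t' @ [a]) ` {..<kap n} \<subseteq> Succs (seqs kap) t'"
    using t'(1) strict_mono_less_eq[OF kap_strict_mono, of n "length t'"] t'(3)
    unfolding Succs_def seqs_def by (auto simp: nth_append less_Suc_eq)
  moreover have "inj_on (\<lambda>a. t' @ [a]) {..<kap n}"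
    by (rule inj_onI) simp
  ultimately have "|{..<kap n}| \<le>o |Succs (seqs kap) t'|"
    using card_of_ordLeq by blast
  then show "\<exists>t' \<in> seqs kap. prefix t t' \<and> |{..<kap n}| \<le>o |Succs (seqs kap) t'|"
    using t' by blast
qed

section \<open>Fusion\<close>

text \<open>\<open>F k\<close> consists of the conditions attached to the nodes of level
  \<open>k\<close>. \<open>Q\<close> need not satisfy \<open>D k\<close> itself; instead
  \<open>F k\<close> is a small set of conditions in \<open>D k\<close> that is predense below
  \<open>Q\<close>.\<close>

lemma fusion:
  assumes T: "T \<in> perfect_trees kap"
    and dense: "\<And>k S. S \<in> perfect_trees kap \<Longrightarrow> S \<subseteq> T \<Longrightarrow> \<exists>S' \<in> perfect_trees kap. S' \<subseteq> S \<and> D k S'"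
  obtains Q F where "Q \<in> perfect_trees kap" "Q \<subseteq> T"
    and "\<forall>k. \<forall>S \<in> F k. S \<in> perfect_trees kap \<and> D k S"
    and "\<exists>S. F 0 = {S}"
    and "\<forall>k. |F (Suc k)| \<le>o |{..<kap k}|"
    and "\<forall>k. \<forall>R \<in> perfect_trees kap. R \<subseteq> Q \<longrightarrow>
      (\<exists>S \<in> F k. \<exists>R' \<in> perfect_trees kap. R' \<subseteq> R \<and> R' \<subseteq> S)"
proof -
  let ?P = "perfect_trees kap"
  \<comment> \<open>The invariant of level \<open>k\<close> for a node paired with its
    condition.\<close>
  define good where "good k x \<longleftrightarrow> snd x \<in> ?P \<and> snd x \<subseteq> T \<and> fst x \<in> snd x \<and>
    snd x \<subseteq> tree_at T (fst x) \<and> D k (snd x)" for k :: nat and x :: "'k list \<times> 'k list set"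
  \<comment> \<open>One fusion step: \<open>s\<close> is a splitting node of the condition, and each
    chosen successor gets its own condition in \<open>D (Suc k)\<close>. Distinct indices give
    distinct nodes, which is needed to count the successors in \<open>Q\<close>.\<close>
  have "\<exists>s F. prefix (fst x) s \<and> inj_on (fst \<circ> F) {..<kap k} \<and>
      (\<forall>a<kap k. fst (F a) \<in> Succs (snd x) s \<and> snd (F a) \<subseteq> snd x \<and> good (Suc k) (F a))"
    if x: "good k x" for k x
  proof -
    obtain s where s: "s \<in> snd x" "prefix (fst x) s" "|{..<kap k}| \<le>o |Succs (snd x) s|"
      using x perfect_tree_split unfolding good_def by metis
    then obtain h where h: "inj_on h {..<kap k}" "h ` {..<kap k} \<subseteq> Succs (snd x) s"
      using card_of_ordLeq[THEN iffD2, OF s(3)] by blast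
    have "\<exists>S \<in> ?P. S \<subseteq> tree_at (snd x) (h a) \<and> D (Suc k) S" if "a < kap k" for a
    proof -
      have "h a \<in> snd x"
        using h(2) that unfolding Succs_def by blast
      then have "tree_at (snd x) (h a) \<in> ?P"
        using x perfect_tree_at unfolding good_def by blast
      moreover have "tree_at (snd x) (h a) \<subseteq> T"
        using x unfolding good_def tree_at_def by blast
      ultimately show ?thesis
        using dense by blast
    qed
    then obtain N where N: "\<And>a. a < kap k \<Longrightarrow>
        N a \<in> ?P \<and> N a \<subseteq> tree_at (snd x) (h a) \<and> D (Suc k) (N a)"
      by metis
    have "prefix (fst x) s \<and> inj_on (fst \<circ> (\<lambda>a. (h a, N a))) {..<kap k} \<and>
      (\<forall>a<kap k. fst (h a, N a) \<in> Succs (snd x) s \<and> snd (h a, N a) \<subseteq> snd x \<and> good (Suc k) (h a, N a))"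
    proof (intro conjI allI impI)
      show "inj_on (fst \<circ> (\<lambda>a. (h a, N a))) {..<kap k}"
        using h(1) by (simp add: o_def)
      fix a assume a: "a < kap k"
      show "fst (h a, N a) \<in> Succs (snd x) s"
        using h(2) a by auto
      show "snd (h a, N a) \<subseteq> snd x"
        using N[OF a] unfolding tree_at_def by auto
      show "good (Suc k) (h a, N a)"
        using N[OF a] x stem_in_subtree[of "N a"] unfolding good_def tree_at_def by auto
    qed (rule s)
    then show ?thesis by blast
  qed
  then obtain s F where s: "\<And>k x. good k x \<Longrightarrow> prefix (fst x) (s k x)"
    and F_inj: "\<And>k x. good k x \<Longrightarrow> inj_on (fst \<circ> F k x) {..<kap k}"
    and F: "\<And>k x a. good k x \<Longrightarrow> a < kap k \<Longrightarrow>
      fst (F k x a) \<in> Succs (snd x) (s k x) \<and> snd (F k x a) \<subseteq> snd x \<and> good (Suc k) (F k x a)"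
    by metis
  obtain S0 where S0: "S0 \<in> ?P" "S0 \<subseteq> T" "D 0 S0"
    using dense[OF T subset_refl] by blast
  \<comment> \<open>the nodes of level \<open>k\<close>, each with a condition whose elements are comparable with the node\<close>
  define A where "A = rec_nat {([], S0)} (\<lambda>k X. \<Union>x \<in> X. F k x ` {..<kap k})"
  have A0: "A 0 = {([], S0)}" and ASuc: "\<And>k. A (Suc k) = (\<Union>x \<in> A k. F k x ` {..<kap k})"
    unfolding A_def by simp_all
  have A_good: "good k x" if "x \<in> A k" for k x
    using that
  proof (induction k arbitrary: x)
    case 0
    then show ?case
      using S0 perfect_treesD(2)[OF S0(1)] by (auto simp: A0 good_def tree_at_def)
  next
    case (Suc k)
    then show ?case
      using F by (auto simp: ASuc)
  qed
  have F_node: "\<exists>b. fst (F k x a) = s k x @ [b]" if "x \<in> A k" "a < kap k" for k x a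
    using F[OF A_good[OF that(1)] that(2)] unfolding Succs_def by blast
  have F_above: "prefix (fst x) (fst (F k x a))" if "x \<in> A k" "a < kap k" for k x a
    using F_node[OF that] s[OF A_good[OF that(1)]] by (metis prefix_prefix)
  have ancestor: "\<exists>x \<in> A k. prefix (fst x) (fst y) \<and> snd y \<subseteq> snd x" if "y \<in> A (k + i)" for k i y
    using that
  proof (induction i arbitrary: y)
    case (Suc i)
    then obtain z a where z: "z \<in> A (k + i)" "a < kap (k + i)" "y = F (k + i) z a"
      by (auto simp: ASuc)
    then have "prefix (fst z) (fst y)" "snd y \<subseteq> snd z"
      using F_above F A_good by blast+
    then show ?case
      using Suc.IH[OF z(1)] by (meson prefix_order.trans subset_trans)
  qed auto
  \<comment> \<open>Nodes of one level are pairwise incomparable. By induction both come from the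
    same node, so both are one-point extensions of the same splitting node; having equal length
    below \<open>t\<close>, they coincide.\<close>
  have uniq: "x = y" if "x \<in> A k" "y \<in> A k" "prefix (fst x) t" "prefix (fst y) t" for k x y t
    using that
  proof (induction k arbitrary: x y)
    case 0
    then show ?case by (simp add: A0)
  next
    case (Suc k)
    then obtain x' a y' b where x': "x' \<in> A k" "a < kap k" "x = F k x' a"
      and y': "y' \<in> A k" "b < kap k" "y = F k y' b"
      by (auto simp: ASuc)
    then have "x' = y'"
      using Suc.IH Suc.prems(3,4) F_above prefix_order.trans by metis
    then have "length (fst x) = length (fst y)"
      using F_node[OF x'(1,2)] F_node[OF y'(1,2)] x'(3) y'(3) by auto
    then have "fst x = fst y"
      using prefix_same_cases[OF Suc.prems(3,4)] prefix_length_prefix[of "fst x" t "fst y"]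
        prefix_length_prefix[of "fst y" t "fst x"] Suc.prems(3,4) prefix_order.antisym by simp
    then have "a = b"
      using inj_onD[OF F_inj[OF A_good[OF x'(1)]], of a b] x'(2,3) y'(2,3) \<open>x' = y'\<close> by simp
    then show ?case
      using x'(3) y'(3) \<open>x' = y'\<close> by simp
  qed
  define Q where "Q = {t. \<exists>k. \<exists>x \<in> A k. prefix t (fst x)}"
  have A_Q: "fst x \<in> Q" if "x \<in> A k" for k x
    using that unfolding Q_def by auto
  have Q_prefix: "t \<in> Q" if "u \<in> Q" "prefix t u" for t u
    using that unfolding Q_def by (blast intro: prefix_order.trans)
  have Q_T: "Q \<subseteq> T"
  proof
    fix t assume "t \<in> Q"
    then obtain k x where "x \<in> A k" "prefix t (fst x)"
      unfolding Q_def by blast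
    then show "t \<in> T"
      using A_good is_treeD[OF perfect_treesD(1)[OF T]] unfolding good_def by blast
  qed
  have kap_ne: "\<exists>a. a < kap k" for k
    using infinite_lessThan_kap[of k] by (metis finite.emptyI lessThan_iff equals0I)
  have descend: "\<exists>y \<in> A (k + i). prefix (fst x) (fst y)" if "x \<in> A k" for k i x
  proof (induction i)
    case 0
    show ?case using that by auto
  next
    case (Suc i)
    then obtain y a where "y \<in> A (k + i)" "prefix (fst x) (fst y)" "a < kap (k + i)"
      using kap_ne by blast
    then have "F (k + i) y a \<in> A (k + Suc i)" "prefix (fst x) (fst (F (k + i) y a))"
      using prefix_order.trans[OF _ F_above[of y "k + i" a]] by (auto simp: ASuc)
    then show ?case
      by blast
  qed
  have Q_perfect: "Q \<in> ?P"
  proof (rule perfect_treeI)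
    show "is_tree kap Q"
      using Q_T Q_prefix perfect_treesD(1)[OF T] unfolding is_tree_def by blast
    show "Q \<noteq> {}"
      using A_Q[of _ 0] by (auto simp: A0)
    fix n t assume "t \<in> Q"
    then obtain k x where "x \<in> A k" "prefix t (fst x)"
      unfolding Q_def by blast
    then obtain y where y: "y \<in> A (k + n)" "prefix t (fst y)"
      using descend[of x k n] by (blast intro: prefix_order.trans)
    \<comment> \<open>Climbing \<open>n\<close> further levels guarantees at least
      \<open>kap n\<close> successors, whatever \<open>k\<close> was.\<close>
    let ?k = "k + n"
    have succ: "fst (F ?k y a) \<in> Succs Q (s ?k y)" if "a < kap ?k" for a
      using F_node[OF y(1) that] A_Q[of "F ?k y a" "Suc ?k"] y(1) that unfolding Succs_def by (auto simp: ASuc)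
    then have "(fst \<circ> F ?k y) ` {..<kap ?k} \<subseteq> Succs Q (s ?k y)"
      by auto
    then have "|{..<kap ?k}| \<le>o |Succs Q (s ?k y)|"
      using F_inj[OF A_good[OF y(1)]] card_of_ordLeq by blast
    moreover have "|{..<kap n}| \<le>o |{..<kap ?k}|"
      using strict_mono_less_eq[OF kap_strict_mono, of n ?k] by (intro card_of_mono1) auto
    ultimately have "|{..<kap n}| \<le>o |Succs Q (s ?k y)|"
      by (rule ordLeq_transitive[rotated])
    moreover have "prefix t (s ?k y)"
      using s[OF A_good[OF y(1)]] y(2) by (blast intro: prefix_order.trans)
    moreover have "s ?k y \<in> Q"
      using kap_ne[of ?k] succ Q_prefix unfolding Succs_def by fastforce
    ultimately show "\<exists>t' \<in> Q. prefix t t' \<and> |{..<kap n}| \<le>o |Succs Q t'|"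
      by blast
  qed
  \<comment> \<open>Take a node \<open>y\<close> of some level above \<open>t\<close>. If that level
    were at most \<open>k\<close>, uniqueness would make \<open>t\<close> an initial segment of
    \<open>fst x\<close>. Otherwise the ancestor of \<open>y\<close> at level \<open>Suc k\<close>
    comes from \<open>x\<close> and is just one longer than \<open>s k x\<close>, so it lies below
    \<open>t\<close>.\<close>
  have through: "\<exists>y \<in> A (Suc k). prefix (fst y) t"
    if t: "t \<in> Q" and x: "x \<in> A k" "prefix (fst x) t" "length (s k x) < length t" for k x t
  proof -
    obtain j y where y: "y \<in> A j" "prefix t (fst y)"
      using t unfolding Q_def by blast
    have "\<not> j \<le> k"
    proof
      assume "j \<le> k"
      then obtain z where z: "z \<in> A j" "prefix (fst z) (fst x)"
        using ancestor[of x j "k - j"] x(1) by auto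
      have "z = y"
        using uniq[OF z(1) y(1), of "fst y"] z(2) x(2) y(2) by (blast intro: prefix_order.trans)
      then have "length t \<le> length (fst x)"
        using z(2) y(2) prefix_length_le by (blast intro: le_trans)
      then show False
        using x(3) prefix_length_le[OF s[OF A_good[OF x(1)]]] by simp
    qed
    then obtain z where z: "z \<in> A (Suc k)" "prefix (fst z) (fst y)"
      using ancestor[of y "Suc k" "j - Suc k"] y(1) by auto
    then obtain x' a where x': "x' \<in> A k" "a < kap k" "z = F k x' a"
      by (auto simp: ASuc)
    have "x' = x"
      using uniq[OF x'(1) x(1), of "fst y"] F_above[OF x'(1,2)] x'(3) z(2) x(2) y(2)
      by (blast intro: prefix_order.trans)
    then have "length (fst z) \<le> length t"
      using F_node[OF x'(1,2)] x'(3) x(3) by auto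
    then have "prefix (fst z) t"
      using prefix_length_prefix[OF z(2) y(2)] by blast
    then show ?thesis
      using z(1) by blast
  qed
  \<comment> \<open>Here it matters that conditions shrink along the levels: a node of
    \<open>Q\<close> properly above \<open>fst x\<close> lies below some later \<open>y\<close>
    descending from \<open>x\<close>, hence in \<open>snd y\<close> and in
    \<open>snd x\<close>.\<close>
  have below: "tree_at Q (fst x) \<subseteq> snd x" if x: "x \<in> A k" for k x
  proof
    fix t assume t: "t \<in> tree_at Q (fst x)"
    have closed: "u \<in> snd y" if "prefix u (fst y)" "y \<in> A j" for u y j
      using A_good[OF that(2)] is_treeD[OF perfect_treesD(1) _ that(1)] unfolding good_def by blast
    show "t \<in> snd x"
    proof (cases "prefix t (fst x)")
      case True
      then show ?thesis using closed x by blast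
    next
      case False
      with t have xt: "prefix (fst x) t" and "t \<in> Q"
        unfolding tree_at_def by auto
      then obtain j y where y: "y \<in> A j" "prefix t (fst y)"
        unfolding Q_def by blast
      show ?thesis
      proof (cases "j \<le> k")
        case True
        then obtain z where z: "z \<in> A j" "prefix (fst z) (fst x)"
          using ancestor[of x j "k - j"] x by auto
        have "z = y"
          using uniq[OF z(1) y(1), of "fst y"] z(2) xt y(2) by (blast intro: prefix_order.trans)
        then show ?thesis
          using False z(2) y(2) by (blast intro: prefix_order.trans)
      next
        case False
        then obtain z where z: "z \<in> A k" "prefix (fst z) (fst y)" "snd y \<subseteq> snd z"
          using ancestor[of y k "j - k"] y(1) by auto
        have "z = x"
          using uniq[OF z(1) x, of "fst y"] z(2) xt y(2) by (blast intro: prefix_order.trans)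
        then show ?thesis
          using closed[OF y(2,1)] z(3) by blast
      qed
    qed
  qed
  \<comment> \<open>\<open>R\<close> has arbitrarily long nodes, so \<open>through\<close> leads it
    from a node of each level to one of the next.\<close>
  have meet: "\<exists>x \<in> A k. fst x \<in> R" if R: "R \<in> ?P" "R \<subseteq> Q" for k R
  proof (induction k)
    case 0
    show ?case
      using perfect_treesD(2)[OF R(1)] by (simp add: A0)
  next
    case (Suc k)
    then obtain x where x: "x \<in> A k" "fst x \<in> R" by blast
    obtain t where t: "t \<in> R" "prefix (fst x) t" "Suc (length (s k x)) \<le> length t"
      using perfect_tree_extend[OF R(1) x(2)] .
    then show ?case
      using through[of t x k] x(1) R is_treeD[OF perfect_treesD(1)[OF R(1)]] by (meson Suc_le_lessD subsetD)
  qed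
  \<comment> \<open>The index shift comes from the root: the single node of level \<open>0\<close>
    has \<open>kap 0\<close> chosen successors. Later levels are unions of at most
    \<open>kap k\<close> sets of size at most \<open>kap k\<close>, for an infinite
    \<open>kap k\<close>.\<close>
  have card: "|A (Suc k)| \<le>o |{..<kap k}|" for k
  proof (induction k)
    case 0
    show ?case
      by (simp add: A0 ASuc[of 0] card_of_image)
  next
    case (Suc k)
    have "|A (Suc k)| \<le>o |{..<kap (Suc k)}|"
      using strict_mono_less_eq[OF kap_strict_mono, of k "Suc k"]
      by (intro ordLeq_transitive[OF Suc] card_of_mono1) auto
    then show ?case
      unfolding ASuc[of "Suc k"]
      by (intro card_of_UNION_ordLeq_infinite[OF infinite_lessThan_kap] ballI card_of_image)
  qed
  show ?thesis
  proof (rule that[of Q "\<lambda>k. snd ` A k"])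
    show "\<forall>k. \<forall>S \<in> snd ` A k. S \<in> ?P \<and> D k S"
      using A_good unfolding good_def by blast
    show "\<exists>S. snd ` A 0 = {S}"
      by (simp add: A0)
    show "\<forall>k. |snd ` A (Suc k)| \<le>o |{..<kap k}|"
      using ordLeq_transitive[OF card_of_image card] by blast
    show "\<forall>k. \<forall>R \<in> ?P. R \<subseteq> Q \<longrightarrow> (\<exists>S \<in> snd ` A k. \<exists>R' \<in> ?P. R' \<subseteq> R \<and> R' \<subseteq> S)"
    proof (intro allI ballI impI)
      fix k R assume R: "R \<in> ?P" "R \<subseteq> Q"
      obtain x where x: "x \<in> A k" "fst x \<in> R"
        using meet[OF R] by blast
      \<comment> \<open>The common extension is \<open>R\<close> restricted to a node of level
        \<open>k\<close> that it contains.\<close>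
      have "tree_at R (fst x) \<subseteq> R" "tree_at R (fst x) \<subseteq> snd x"
        using below[OF x(1)] R(2) unfolding tree_at_def by auto
      then show "\<exists>S \<in> snd ` A k. \<exists>R' \<in> ?P. R' \<subseteq> R \<and> R' \<subseteq> S"
        using perfect_tree_at[OF R(1) x(2)] x(1) by blast
    qed
  qed (use Q_perfect Q_T in auto)
qed

end


section \<open>The covering theorem\<close>

theorem theorem3p9:
  fixes kap :: "nat \<Rightarrow> 'k::wellorder"
    and \<mu> :: "nat \<Rightarrow> 'k"
    and T :: "'k list set"
    and g :: "('k list set, 'i) name"
  assumes "singular_setting kap"
    and "has_cofinality (wo :: 'k rel) natLeq"
    and "\<And>n. \<mu> n \<noteq> (LEAST a. True)"
    and "mono \<mu>"
    and "filterlim \<mu> at_top sequentially"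
    and "card_order (wo :: 'l::wellorder rel)"
    and "(wo :: 'l rel) =o (wo :: 'k rel) ^c natLeq"
    and "|UNIV :: 'l set| \<le>o |UNIV :: 'i set|"
    and "T \<in> perfect_trees kap"
    and "is_name (perfect_trees kap) g"
    and "forces (perfect_trees kap) (\<subseteq>) T
           (is_fun_fm (seqs kap) g
              (check_set (seqs kap) (UNIV :: nat set))
              (check_set (seqs kap) (UNIV :: 'l set)))"
  shows "\<exists>Q \<in> perfect_trees kap. \<exists>f :: nat \<Rightarrow> 'l set. Q \<subseteq> T \<and>
           (\<forall>n. |f n| \<le>o seg (\<mu> n) \<and>
                forces (perfect_trees kap) (\<subseteq>) Q
                  (app_mem_app_fm (seqs kap) g (check_fun (seqs kap) f)
                     (check_ord (seqs kap) n)))"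
  proof -
  interpret singular_setting kap by (rule assms(1))
  let ?P = "perfect_trees kap" and ?one = "seqs kap"
  interpret forcing_preorder ?P "(\<subseteq>)" by unfold_locales auto
  have wo_Field: "Field (wo :: 'k rel) = UNIV"
    unfolding wo_def Field_def by auto
  have inf_k: "infinite (UNIV :: 'k set)"
    using infinite_lessThan_kap[of 0] finite_subset[OF subset_UNIV] by blast
  have one: "?one \<in> ?P" "\<And>q. q \<in> ?P \<Longrightarrow> q \<subseteq> ?one"
    using seqs_perfect perfect_treesD(1) unfolding is_tree_def by blast+
  \<comment> \<open>From \<kappa> \<le> \<kappa>^\<omega> = \<lambda> it follows that the index type
    of the names is infinite, as pairs and check names require.\<close>
  have k_l: "|UNIV :: 'k set| \<le>o |UNIV :: 'l set|"
  proof -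
    have "|UNIV :: 'k set| =o (wo :: 'k rel)"
      using kappa_cardinal(1) card_of_unique ordIso_symmetric by blast
    also have "(wo :: 'k rel) =o (wo :: 'k rel) ^c cone"
      using kappa_cardinal(1) wo_Field by (simp add: cexp_cone ordIso_symmetric)
    also have "(wo :: 'k rel) ^c cone \<le>o (wo :: 'k rel) ^c natLeq"
      using kappa_cardinal(1) wo_Field cone_not_czero Card_order_cone
      by (intro cexp_mono2_Cnotzero cone_ordLeq_Cnotzero[OF Cinfinite_Cnotzero[OF natLeq_Cinfinite]]) auto
    also have "(wo :: 'k rel) ^c natLeq =o (wo :: 'l rel)"
      using assms(7) ordIso_symmetric by blast
    also have "(wo :: 'l rel) =o |UNIV :: 'l set|"
      using assms(6) by (rule card_of_unique)
    finally show ?thesis .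
  qed
  have inf: "infinite (UNIV :: 'i set)"
    using card_of_ordLeq_infinite[OF ordLeq_transitive[OF k_l assms(8)] inf_k] .
  let ?val = "\<lambda>n v. forces_mem ?P (\<subseteq>) (op_name ?one (check_ord ?one (n::nat)) (check_ord ?one (v::'l))) g"
  define D where "D k S \<longleftrightarrow> (\<forall>n. \<mu> n < kap k \<longrightarrow> (\<exists>v. ?val n v S))" for k S
  have dense: "\<exists>S' \<in> ?P. S' \<subseteq> S \<and> D k S'" if S: "S \<in> ?P" "S \<subseteq> T" for k S
  proof -
    \<comment> \<open>Values are decided one argument at a time; by monotonicity, strengthening the
      condition keeps those already decided.\<close>
    have fin: "\<exists>S' \<in> ?P. S' \<subseteq> S \<and> (\<forall>n \<in> N. \<exists>v. ?val n v S')" if "finite N" for N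
      using that
    proof induction
      case empty
      show ?case using S(1) by blast
    next
      case (insert n N)
      then obtain S1 where S1: "S1 \<in> ?P" "S1 \<subseteq> S" "\<forall>n \<in> N. \<exists>v. ?val n v S1" by blast
      obtain S2 v where "S2 \<in> ?P" "S2 \<subseteq> S1" "?val n v S2"
        using decide_value[OF inf assms(8) one assms(11) S1(1) subset_trans[OF S1(2) S(2)], of n] .
      then show ?case
        using S1 forces_mem_mono[of _ g S1 S2] by (intro bexI[of _ S2]) blast+
    qed
    have "finite {n. \<mu> n < kap k}"
    proof -
      have "\<forall>\<^sub>F n in sequentially. kap k \<le> \<mu> n"
        using assms(5) by (simp add: filterlim_at_top)
      then obtain m where "\<forall>n\<ge>m. kap k \<le> \<mu> n"
        by (auto simp: eventually_sequentially)
      then have "{n. \<mu> n < kap k} \<subseteq> {..<m}"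
        by (auto simp: not_le[symmetric])
      then show ?thesis
        using finite_subset by blast
    qed
    from fin[OF this] show ?thesis
      unfolding D_def mem_Collect_eq Ball_def .
  qed
  obtain Q F where Q: "Q \<in> ?P" "Q \<subseteq> T"
    and F: "\<forall>k. \<forall>S \<in> F k. S \<in> ?P \<and> D k S"
    and F0: "\<exists>S. F 0 = {S}"
    and FSuc: "\<forall>k. |F (Suc k)| \<le>o |{..<kap k}|"
    and predense: "\<forall>k. \<forall>R \<in> ?P. R \<subseteq> Q \<longrightarrow> (\<exists>S \<in> F k. \<exists>R' \<in> ?P. R' \<subseteq> R \<and> R' \<subseteq> S)"
    using fusion[where D = D, OF assms(9) dense] .
  \<comment> \<open>Minimality gives \<open>kap k \<le> \<mu> n\<close> when
    \<open>lev n = Suc k\<close>, which matches the bound on \<open>F (Suc k)\<close>.\<close>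
  define lev where "lev n = (LEAST k. \<mu> n < kap k)" for n
  have lev: "\<mu> n < kap (lev n)" for n
    unfolding lev_def using kap_sup by (rule LeastI_ex)
  \<comment> \<open>Choosing one forced value per condition makes \<open>f n\<close> an image of
    \<open>F (lev n)\<close>, hence no larger.\<close>
  define val where "val n S = (SOME v. ?val n v S)" for n S
  have val: "?val n (val n S) S" if "S \<in> F (lev n)" for n S
  proof -
    have "\<exists>v. ?val n v S"
      using F that lev[of n] unfolding D_def by blast
    then show ?thesis
      unfolding val_def by (rule someI_ex)
  qed
  define f where "f n = val n ` F (lev n)" for n
  have "|f n| \<le>o seg (\<mu> n)" for n
  proof -
    have "|F (lev n)| \<le>o |{..<\<mu> n}|"
    proof (cases "lev n")
      case 0
      \<comment> \<open>At level \<open>0\<close> there is a single condition and so a single value,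
        and the nonzero \<open>\<mu> n\<close> leaves room for it.\<close>
      have "(LEAST a. True) < \<mu> n"
        using assms(3)[of n] Least_le[of "\<lambda>_. True" "\<mu> n"] by simp
      then have "{..<\<mu> n} \<noteq> {}" by blast
      moreover obtain S where "F (lev n) = {S}"
        using F0 0 by auto
      ultimately show ?thesis
        using card_of_singl_ordLeq by metis
    next
      case (Suc k)
      then have "kap k \<le> \<mu> n"
        using not_less_Least[of k "\<lambda>k. \<mu> n < kap k"] unfolding lev_def by auto
      then show ?thesis
        unfolding Suc by (intro ordLeq_transitive[OF FSuc[rule_format]] card_of_mono1) auto
    qed
    then show ?thesis
      unfolding f_def
      using ordLeq_transitive[OF card_of_image] ordLeq_transitive[OF _ card_of_lessThan_le_seg] by blast
  qed
  moreover have "forces ?P (\<subseteq>) Q (app_mem_app_fm ?one g (check_fun ?one f) (check_ord ?one n))" for n :: nat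
  \<comment> \<open>Predensity of \<open>F (lev n)\<close> below \<open>Q\<close> becomes density of
    the conditions forcing a value in \<open>f n\<close>, since what \<open>S\<close> forces passes
    to \<open>R'\<close>.\<close>
  proof (rule forces_app_mem_appI[OF inf assms(8) one])
    fix R assume "R \<in> ?P" "R \<subseteq> Q"
    then obtain S R' where S: "S \<in> F (lev n)" "R' \<in> ?P" "R' \<subseteq> R" "R' \<subseteq> S"
      using predense by blast
    then show "\<exists>q \<in> ?P. q \<subseteq> R \<and> (\<exists>v \<in> f n. ?val n v q)"
      using forces_mem_mono[OF val[OF S(1)] S(4)] unfolding f_def by blast
  qed
  ultimately show ?thesis
    using Q by blast
qed

end
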